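(* Let $P\ge1$ and let integers $m_1,\dots,m_P\ge2$, not all equal, and reals $\beta_1,\dots,\beta_P>0$ be fixed, and put $\beta=\sum_{p=1}^P\beta_p$. Consider hypercuboid networks with $K=\sum_{p=1}^Pr_pm_p$ nodes and parameters $m_1,\dots,m_P$, $r_1,\dots,r_P$ such that $\frac{r_p}{K}=\beta_p$ for all $p$, so that $r=\sum_pr_p$ satisfies $\frac rK=\beta$, and let $K\to\infty$ along such networks. Then $$\lim_{K\to\infty}\frac{L_{\rm c}(r)}{L_1(r)}=\frac1{1-\beta}\left(\frac{1}{\sum_{p=1}^P\frac{\beta_p}{\beta}\frac{m_p}{m_p-1}}\right)<1.$$
   Context: $r_1,\dots,r_P$ are positive integers. $L_{\rm c}(r)=\frac1{r-1}\cdot\frac{r}{\sum_{p=1}^P\frac{r_pm_p}{m_p-1}}$ is the communication load of the hypercuboid (heterogeneous) coded distributed computing scheme with parameters $m_1,\dots,m_P,r_1,\dots,r_P$, where $r=\sum_pr_p$ is its computation load and $K=\sum_pr_pm_p$ its number of nodes ($r_pm_p$ nodes each store a fraction $1/m_p$ of the files). $L_1(r)=\frac1r\left(1-\frac rK\right)$ is the communication load of the homogeneous coded distributed computing scheme of Li et al. with the same $K$ and $r$. *)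

theory Defs
  imports Complex_Main
begin

definition hypercuboid_params :: "nat \<Rightarrow> (nat \<Rightarrow> nat) \<Rightarrow> (nat \<Rightarrow> nat) \<Rightarrow> bool" where
  "hypercuboid_params P m r \<longleftrightarrow> 1 \<le> P \<and> (\<forall>p\<in>{1..P}. 2 \<le> m p \<and> 0 < r p)"

definition num_nodes :: "nat \<Rightarrow> (nat \<Rightarrow> nat) \<Rightarrow> (nat \<Rightarrow> nat) \<Rightarrow> nat" where
  "num_nodes P m r = (\<Sum>p=1..P. r p * m p)"

definition comp_load :: "nat \<Rightarrow> (nat \<Rightarrow> nat) \<Rightarrow> nat" where
  "comp_load P r = (\<Sum>p=1..P. r p)"

text \<open>
  Communication load of the hypercuboid scheme with parameters \<open>m\<close> and \<open>r\<close>. The formula is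
  meaningful for computation load at least 2; this holds for all positive \<open>r\<close> once \<open>P \<ge> 2\<close>,
  in particular whenever the \<open>m p\<close> are not all equal.
\<close>

definition L_c :: "nat \<Rightarrow> (nat \<Rightarrow> nat) \<Rightarrow> (nat \<Rightarrow> nat) \<Rightarrow> real" where
  "L_c P m r =
     1 / (real (comp_load P r) - 1) *
     (real (comp_load P r) / (\<Sum>p=1..P. real (r p) * real (m p) / (real (m p) - 1)))"

text \<open>
  Communication load of the homogeneous scheme of Li et al. with \<open>K\<close> nodes and computation
  load \<open>s\<close>.
\<close>

definition L_1 :: "nat \<Rightarrow> nat \<Rightarrow> real" where
  "L_1 K s = 1 / real s * (1 - real s / real K)"

end

(* Since r_p = beta_p K, the ratio of the loads equals l * r / (r - 1) with r = beta K, which tends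
   to l. Dividing K by itself gives the sum of beta_p m_p as 1, so with x_p = m_p - 1 the bound
   l < 1 becomes the strict weighted Cauchy-Schwarz inequality
   beta^2 < (sum of beta_p x_p) (sum of beta_p / x_p), strict because the x_p are not all equal. *)
theory Submission
  imports Defs "HOL-Real_Asymp.Real_Asymp"
begin

text \<open>With \<open>b\<close> the total weight, \<open>M / b\<close> is the weighted mean of
  \<open>x\<close>. Weighting the squares \<open>(b * x a - M)\<^sup>2\<close> by
  \<open>w a / x a\<close> and summing gives \<open>M * (M * T - b\<^sup>2)\<close>, which is
  positive because a nonconstant \<open>x\<close> misses its mean somewhere.\<close>

lemma weighted_AM_HM_strict:
  fixes w x :: "'a \<Rightarrow> real"
  assumes fin: "finite A"
    and w: "\<And>a. a \<in> A \<Longrightarrow> 0 < w a"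
    and x: "\<And>a. a \<in> A \<Longrightarrow> 0 < x a"
    and pq: "p \<in> A" "q \<in> A" "x p \<noteq> x q"
  shows "(sum w A)\<^sup>2 < (\<Sum>a\<in>A. w a * x a) * (\<Sum>a\<in>A. w a / x a)"
proof -
  define b where "b = sum w A"
  define M where "M = (\<Sum>a\<in>A. w a * x a)"
  define T where "T = (\<Sum>a\<in>A. w a / x a)"
  have M: "0 < M" unfolding M_def using fin pq w x by (intro sum_pos) auto
  have b: "0 < b" unfolding b_def using fin pq w by (intro sum_pos) auto
  \<comment> \<open>One of \<open>p\<close> and \<open>q\<close> serves: if both gave equality,
    cancelling \<open>b\<close> would force \<open>x p = x q\<close>.\<close>
  obtain k where k: "k \<in> A" "b * x k \<noteq> M"
    using pq b by (metis less_irrefl mult_left_cancel)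
  have "0 < (\<Sum>a\<in>A. w a * (b * x a - M)\<^sup>2 / x a)"
  proof (rule sum_pos2[OF fin k(1)])
    show "0 < w k * (b * x k - M)\<^sup>2 / x k" using k w x by simp
    show "0 \<le> w a * (b * x a - M)\<^sup>2 / x a" if "a \<in> A" for a
      using w[OF that] x[OF that] by simp
  qed
  also have "(\<Sum>a\<in>A. w a * (b * x a - M)\<^sup>2 / x a) =
      (\<Sum>a\<in>A. b\<^sup>2 * (w a * x a) - 2 * b * M * w a + M\<^sup>2 * (w a / x a))"
  proof (rule sum.cong[OF refl])
    fix a assume "a \<in> A"
    then have "x a \<noteq> 0" using x by force
    then show "w a * (b * x a - M)\<^sup>2 / x a =
        b\<^sup>2 * (w a * x a) - 2 * b * M * w a + M\<^sup>2 * (w a / x a)"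
      by (simp add: field_simps power2_eq_square)
  qed
  also have "\<dots> = b\<^sup>2 * M - 2 * b * M * b + M\<^sup>2 * T"
    by (simp add: sum.distrib sum_subtractf sum_distrib_left b_def M_def T_def)
  also have "\<dots> = M * (M * T - b\<^sup>2)"
    by (simp add: algebra_simps power2_eq_square)
  finally show ?thesis
    using M by (simp add: zero_less_mult_iff b_def M_def T_def)
qed

theorem mainTheorem7:
  fixes P :: nat
    and m :: "nat \<Rightarrow> nat"
    and \<beta> :: "nat \<Rightarrow> real"
    and r :: "nat \<Rightarrow> nat \<Rightarrow> nat"
  assumes "1 \<le> P"
    and "\<forall>p\<in>{1..P}. 2 \<le> m p"
    and "\<exists>p\<in>{1..P}. \<exists>q\<in>{1..P}. m p \<noteq> m q"
    and "\<forall>p\<in>{1..P}. 0 < \<beta> p"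
    and "\<forall>n. hypercuboid_params P m (r n)"
    and "\<forall>n. \<forall>p\<in>{1..P}. real (r n p) / real (num_nodes P m (r n)) = \<beta> p"
    and "filterlim (\<lambda>n. num_nodes P m (r n)) at_top sequentially"
  shows "(let b = (\<Sum>p=1..P. \<beta> p);
              l = 1 / (1 - b) *
                  (1 / (\<Sum>p=1..P. \<beta> p / b * (real (m p) / (real (m p) - 1))))
          in ((\<lambda>n. L_c P m (r n) / L_1 (num_nodes P m (r n)) (comp_load P (r n)))
                \<longlonglongrightarrow> l)
             \<and> l < 1)"
proof -
  define b where "b = (\<Sum>p=1..P. \<beta> p)"
  define S where "S = (\<Sum>p=1..P. \<beta> p * real (m p) / (real (m p) - 1))"
  define K where "K = (\<lambda>n. real (num_nodes P m (r n)))"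
  define R where "R = (\<lambda>n. real (comp_load P (r n)))"
  have m: "2 \<le> real (m p)" if "p \<in> {1..P}" for p
    using assms(2) that by fastforce
  \<comment> \<open>Positivity allows clearing the denominator in
    \<open>r n p / K n = \<beta> p\<close>, where a zero denominator would only yield the default
    value 0.\<close>
  have Kpos: "0 < K n" for n
  proof -
    have "0 < r n 1 * m 1" "1 \<in> {1..P}"
      using assms(1,5) unfolding hypercuboid_params_def by fastforce+
    then have "0 < (\<Sum>p=1..P. r n p * m p)"
      by (intro sum_pos2[of _ 1]) auto
    then show ?thesis unfolding K_def num_nodes_def of_nat_0_less_iff .
  qed
  have r: "real (r n p) = \<beta> p * K n" if "p \<in> {1..P}" for n p
  proof -
    have "real (r n p) / K n = \<beta> p" using assms(6) that by (simp add: K_def)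
    then show ?thesis using Kpos[of n] by (simp add: field_simps)
  qed
  \<comment> \<open>A single network already forces this relation between \<open>\<beta>\<close> and
    \<open>m\<close>; the index 0 is an arbitrary choice.\<close>
  have bm: "(\<Sum>p=1..P. \<beta> p * real (m p)) = 1"
  proof -
    have "K 0 = (\<Sum>p=1..P. real (r 0 p) * real (m p))"
      by (simp add: K_def num_nodes_def)
    also have "\<dots> = K 0 * (\<Sum>p=1..P. \<beta> p * real (m p))"
      unfolding sum_distrib_left by (rule sum.cong) (simp_all add: r)
    finally show ?thesis using Kpos[of 0] by simp
  qed
  have R: "R n = b * K n" for n
    unfolding R_def comp_load_def b_def of_nat_sum sum_distrib_right
    by (rule sum.cong) (simp_all add: r)
  have bpos: "0 < b"
    unfolding b_def using assms(1,4) by (intro sum_pos) auto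
  have Spos: "0 < S"
    unfolding S_def using assms(1,4) m by (intro sum_pos divide_pos_pos mult_pos_pos) force+
  have M: "(\<Sum>p=1..P. \<beta> p * (real (m p) - 1)) = 1 - b"
    using bm by (simp add: right_diff_distrib sum_subtractf b_def)
  have "0 < (\<Sum>p=1..P. \<beta> p * (real (m p) - 1))"
    using assms(1,4) m by (intro sum_pos mult_pos_pos) force+
  then have b1: "b < 1" unfolding M by simp
  obtain p q where pq: "p \<in> {1..P}" "q \<in> {1..P}" "m p \<noteq> m q"
    using assms(3) by blast
  \<comment> \<open>By \<open>M\<close>, the factor \<open>1 - b\<close> is the
    \<open>\<beta>\<close>-weighted sum of the \<open>m p - 1\<close>, so the lemma applies with
    \<open>x p = m p - 1\<close>.\<close>
  have "b\<^sup>2 < (1 - b) * (\<Sum>p=1..P. \<beta> p / (real (m p) - 1))"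
    unfolding M[symmetric] unfolding b_def
  proof (rule weighted_AM_HM_strict[OF _ _ _ pq(1,2)])
    show "0 < real (m a) - 1" if "a \<in> {1..P}" for a using m[OF that] by simp
  qed (use assms(4) pq in auto)
  \<comment> \<open>Termwise \<open>m / (m - 1) = 1 + 1 / (m - 1)\<close>. The previous bound then
    reads \<open>b\<^sup>2 < (1 - b) * (S - b)\<close>, and \<open>b\<^sup>2\<close> cancels after
    expansion.\<close>
  moreover have "S = b + (\<Sum>p=1..P. \<beta> p / (real (m p) - 1))"
    unfolding S_def b_def sum.distrib[symmetric]
  proof (rule sum.cong[OF refl])
    fix a assume "a \<in> {1..P}"
    then show "\<beta> a * real (m a) / (real (m a) - 1) = \<beta> a + \<beta> a / (real (m a) - 1)"
      using m[of a] by (simp add: field_simps)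
  qed
  ultimately have bS: "b < (1 - b) * S"
    by (simp add: algebra_simps power2_eq_square)
  define l where "l = b / ((1 - b) * S)"
  have l1: "l < 1" using bS bpos by (simp add: l_def)
  have "(\<Sum>p=1..P. \<beta> p / b * (real (m p) / (real (m p) - 1))) = S / b"
    by (simp add: S_def sum_divide_distrib mult.commute)
  then have l: "1 / (1 - b) * (1 / (\<Sum>p=1..P. \<beta> p / b * (real (m p) / (real (m p) - 1)))) = l"
    by (simp add: l_def)
  \<comment> \<open>An exact identity for each \<open>n\<close>: one factor \<open>R n / K n\<close>
    in \<open>L_c\<close> is the constant \<open>b\<close>, and \<open>L_1\<close> is
    \<open>(1 - b) / R n\<close>. At \<open>R n = 1\<close> both sides would be 0, by the convention
    for division by zero.\<close>
  have ratio: "L_c P m (r n) / L_1 (num_nodes P m (r n)) (comp_load P (r n)) =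
      l * (R n / (R n - 1))" for n
  proof -
    have "(\<Sum>p=1..P. real (r n p) * real (m p) / (real (m p) - 1)) = K n * S"
      unfolding S_def sum_distrib_left by (rule sum.cong) (simp_all add: r)
    then have Lc: "L_c P m (r n) = 1 / (R n - 1) * (b / S)"
      using Kpos[of n] R[of n] by (simp add: L_c_def R_def)
    have "R n / K n = b" using R[of n] Kpos[of n] by simp
    then have "L_1 (num_nodes P m (r n)) (comp_load P (r n)) = (1 - b) / R n"
      by (simp add: L_1_def R_def K_def)
    then show ?thesis unfolding Lc by (simp add: l_def)
  qed
  have "filterlim K at_top sequentially"
    unfolding K_def by (rule filterlim_compose[OF filterlim_real_sequentially assms(7)])
  \<comment> \<open>\<open>R\<close> is \<open>K\<close> scaled by the fixed positive constant
    \<open>b\<close>, so it diverges along with \<open>K\<close>.\<close>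
  then have Rtop: "filterlim R at_top sequentially"
    using filterlim_tendsto_pos_mult_at_top[OF tendsto_const bpos] by (simp add: R[abs_def])
  have lim: "((\<lambda>x::real. x / (x - 1)) \<longlongrightarrow> 1) at_top"
    by real_asymp
  have "(\<lambda>n. l * (R n / (R n - 1))) \<longlonglongrightarrow> l * 1"
    by (intro tendsto_mult tendsto_const filterlim_compose[OF lim Rtop])
  then show ?thesis
    unfolding Let_def b_def[symmetric] l ratio using l1 by simp
qed

end
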